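(* Let $M$ be a monoid, let $A$ be an $M$-act and let $B$ be a subact of $A$. If $B$ and the Rees quotient $A/B$ are finitely presented, then $A$ is finitely presented.
   Context: Let $M$ be a monoid with identity $1$. A (right) $M$-act is a non-empty set $A$ with a map $A\times M\to A$, $(a,m)\mapsto am$, with $a(mn)=(am)n$ and $a1=a$. A subact of $A$ is a non-empty subset $B$ with $bm\in B$ for all $b\in B$, $m\in M$. A congruence on $A$ is an equivalence relation $\rho$ with $(a,b)\in\rho\Rightarrow(am,bm)\in\rho$ for all $m\in M$. For a subact $B$ of $A$, the Rees quotient $A/B$ is the quotient of $A$ by the congruence $a\,\rho_B\,b\iff a=b$ or $a,b\in B$. For a set $X$, $F_X=X\times M$ is the free $M$-act with $(x,m)n=(x,mn)$. A presentation $\langle X\,|\,R\rangle$ consists of a non-empty set $X$ and a set $R\subseteq F_X\times F_X$; an $M$-act is defined by it if it is isomorphic to $F_X/\rho$, where $\rho$ is the smallest congruence on $F_X$ containing $R$. An $M$-act is finitely presented if it is defined by some presentation $\langle X\,|\,R\rangle$ with $X$ and $R$ finite. *)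

theory Defs
  imports "HOL-Algebra.Group"
begin

locale right_act = monoid M for M (structure) +
  fixes A :: "'a set" and act :: "'a \<Rightarrow> 'm \<Rightarrow> 'a"
  assumes act_nonempty: "A \<noteq> {}"
    and act_closed: "\<lbrakk>a \<in> A; m \<in> carrier M\<rbrakk> \<Longrightarrow> act a m \<in> A"
    and act_mult: "\<lbrakk>a \<in> A; m \<in> carrier M; n \<in> carrier M\<rbrakk> \<Longrightarrow> act a (m \<otimes> n) = act (act a m) n"
    and act_one: "a \<in> A \<Longrightarrow> act a \<one> = a"

text \<open>A subact of \<open>(A, act)\<close> is a subset of \<open>A\<close>, regarded as an act with the same function \<open>act\<close>;
  only the values of \<open>act\<close> on the carrier are ever relevant.\<close>

definition subact :: "('m, 'k) monoid_scheme \<Rightarrow> 'a set \<Rightarrow> ('a \<Rightarrow> 'm \<Rightarrow> 'a) \<Rightarrow> 'a set \<Rightarrow> bool" where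
  "subact M A act B \<longleftrightarrow> B \<subseteq> A \<and> B \<noteq> {} \<and> (\<forall>b\<in>B. \<forall>m\<in>carrier M. act b m \<in> B)"

definition act_congruence ::
    "('m, 'k) monoid_scheme \<Rightarrow> 'a set \<Rightarrow> ('a \<Rightarrow> 'm \<Rightarrow> 'a) \<Rightarrow> ('a \<times> 'a) set \<Rightarrow> bool" where
  "act_congruence M A act \<rho> \<longleftrightarrow>
     equiv A \<rho> \<and> (\<forall>(a, b)\<in>\<rho>. \<forall>m\<in>carrier M. (act a m, act b m) \<in> \<rho>)"

text \<open>The action on the classes \<open>A // \<rho>\<close>; for a congruence \<open>\<rho>\<close> the union is that of a single class
  (see \<open>quotient_act_class\<close> below).\<close>

definition quotient_act ::
    "('a \<times> 'a) set \<Rightarrow> ('a \<Rightarrow> 'm \<Rightarrow> 'a) \<Rightarrow> 'a set \<Rightarrow> 'm \<Rightarrow> 'a set" where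
  "quotient_act \<rho> act C m = (\<Union>a\<in>C. \<rho> `` {act a m})"

definition rees_congruence :: "'a set \<Rightarrow> 'a set \<Rightarrow> ('a \<times> 'a) set" where
  "rees_congruence A B = {(a, b). a \<in> A \<and> b \<in> A \<and> (a = b \<or> a \<in> B \<and> b \<in> B)}"

definition acts_isomorphic ::
    "('m, 'k) monoid_scheme \<Rightarrow> 'a set \<Rightarrow> ('a \<Rightarrow> 'm \<Rightarrow> 'a) \<Rightarrow> 'b set \<Rightarrow> ('b \<Rightarrow> 'm \<Rightarrow> 'b) \<Rightarrow> bool" where
  "acts_isomorphic M A act A' act' \<longleftrightarrow>
     (\<exists>f. bij_betw f A A' \<and> (\<forall>a\<in>A. \<forall>m\<in>carrier M. f (act a m) = act' (f a) m))"

definition free_carrier :: "('m, 'k) monoid_scheme \<Rightarrow> 'x set \<Rightarrow> ('x \<times> 'm) set" where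
  "free_carrier M X = X \<times> carrier M"

definition free_act :: "('m, 'k) monoid_scheme \<Rightarrow> 'x \<times> 'm \<Rightarrow> 'm \<Rightarrow> 'x \<times> 'm" where
  "free_act M p n = (fst p, snd p \<otimes>\<^bsub>M\<^esub> n)"

definition generated_congruence ::
    "('m, 'k) monoid_scheme \<Rightarrow> 'a set \<Rightarrow> ('a \<Rightarrow> 'm \<Rightarrow> 'a) \<Rightarrow> ('a \<times> 'a) set \<Rightarrow> ('a \<times> 'a) set" where
  "generated_congruence M A act R = \<Inter>{\<rho>. act_congruence M A act \<rho> \<and> R \<subseteq> \<rho>}"

definition act_presentation ::
    "('m, 'k) monoid_scheme \<Rightarrow> 'x set \<Rightarrow> (('x \<times> 'm) \<times> ('x \<times> 'm)) set \<Rightarrow> bool" where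
  "act_presentation M X R \<longleftrightarrow> X \<noteq> {} \<and> R \<subseteq> free_carrier M X \<times> free_carrier M X"

definition defined_by ::
    "('m, 'k) monoid_scheme \<Rightarrow> 'a set \<Rightarrow> ('a \<Rightarrow> 'm \<Rightarrow> 'a) \<Rightarrow>
     'x set \<Rightarrow> (('x \<times> 'm) \<times> ('x \<times> 'm)) set \<Rightarrow> bool" where
  "defined_by M A act X R \<longleftrightarrow>
     act_presentation M X R \<and>
     (let \<rho> = generated_congruence M (free_carrier M X) (free_act M) R
      in acts_isomorphic M A act (free_carrier M X // \<rho>) (quotient_act \<rho> (free_act M)))"

text \<open>A type cannot be quantified existentially, so the finite generating set \<open>X\<close> is taken inside
  \<open>nat\<close>. This is no restriction: by \<open>finitely_presentedI\<close> below, finite presentations over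
  generators of an arbitrary type give the same notion.\<close>

definition finitely_presented ::
    "('m, 'k) monoid_scheme \<Rightarrow> 'a set \<Rightarrow> ('a \<Rightarrow> 'm \<Rightarrow> 'a) \<Rightarrow> bool" where
  "finitely_presented M A act \<longleftrightarrow>
     (\<exists>(X :: nat set) R. finite X \<and> finite R \<and> defined_by M A act X R)"

lemma rees_congruence:
  assumes "subact M A act B" and "right_act M A act"
  shows "act_congruence M A act (rees_congruence A B)"
proof -
  interpret right_act M A act by fact
  show ?thesis
    using assms(1) act_closed
    unfolding act_congruence_def rees_congruence_def subact_def
    by (auto intro!: equivI simp: refl_on_def sym_def trans_def)
qed

lemma right_act_subact:
  assumes "subact M A act B" and "right_act M A act"
  shows "right_act M B act"
proof -
  interpret right_act M A act by fact
  show ?thesis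
    using assms(1) act_mult act_one unfolding subact_def by unfold_locales auto
qed

lemma quotient_act_class:
  assumes "act_congruence M A act \<rho>" and "a \<in> A" and "m \<in> carrier M"
  shows "quotient_act \<rho> act (\<rho> `` {a}) m = \<rho> `` {act a m}"
proof -
  have eq: "equiv A \<rho>" and c: "\<And>a b. (a, b) \<in> \<rho> \<Longrightarrow> (act a m, act b m) \<in> \<rho>"
    using assms unfolding act_congruence_def by auto
  have "\<rho> `` {act b m} = \<rho> `` {act a m}" if "b \<in> \<rho> `` {a}" for b
    using equiv_class_eq[OF eq c[of a b]] that by auto
  moreover have "a \<in> \<rho> `` {a}" using equiv_class_self[OF eq assms(2)] .
  ultimately show ?thesis unfolding quotient_act_def by blast
qed

lemma right_act_quotient:
  assumes "act_congruence M A act \<rho>" and "right_act M A act"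
  shows "right_act M (A // \<rho>) (quotient_act \<rho> act)"
proof -
  interpret right_act M A act by fact
  note q = quotient_act_class[OF assms(1)]
  show ?thesis
  proof
    show "A // \<rho> \<noteq> {}" using act_nonempty by (auto simp: quotient_def)
  qed (auto elim!: quotientE simp: q act_closed act_mult act_one intro!: quotientI)
qed

lemma right_act_free:
  assumes "monoid M" and "X \<noteq> {}"
  shows "right_act M (free_carrier M X) (free_act M)"
proof -
  interpret monoid M by fact
  show ?thesis
    using assms(2) one_closed
    by unfold_locales (auto simp: free_carrier_def free_act_def m_assoc)
qed

lemma generated_congruence:
  assumes "right_act M A act" and "R \<subseteq> A \<times> A"
  shows "act_congruence M A act (generated_congruence M A act R)"
proof -
  interpret right_act M A act by fact
  let ?S = "{\<rho>. act_congruence M A act \<rho> \<and> R \<subseteq> \<rho>}"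
  have "A \<times> A \<in> ?S"
    using assms(2) act_closed
    unfolding act_congruence_def by (auto intro!: equivI simp: refl_on_def sym_def trans_def)
  hence sub: "\<Inter>?S \<subseteq> A \<times> A" by blast
  have 1: "equiv A \<rho>" if "\<rho> \<in> ?S" for \<rho> using that unfolding act_congruence_def by auto
  have "refl_on A (\<Inter>?S)" using 1 unfolding equiv_def refl_on_def by blast
  moreover have "sym (\<Inter>?S)" using 1 unfolding equiv_def sym_def by blast
  moreover have "trans (\<Inter>?S)" using 1 unfolding equiv_def trans_def by blast
  ultimately have "equiv A (\<Inter>?S)" using sub by (auto intro!: equivI)
  moreover have "(act a m, act b m) \<in> \<Inter>?S" if "(a, b) \<in> \<Inter>?S" "m \<in> carrier M" for a b m
    using that unfolding act_congruence_def by fast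
  ultimately show ?thesis
    unfolding generated_congruence_def act_congruence_def[of _ _ _ "\<Inter>?S"] by blast
qed

lemma generated_congruence_base: "R \<subseteq> generated_congruence M A act R"
  unfolding generated_congruence_def by blast

lemma generated_congruence_least:
  assumes "act_congruence M A act \<rho>" and "R \<subseteq> \<rho>"
  shows "generated_congruence M A act R \<subseteq> \<rho>"
  using assms unfolding generated_congruence_def by blast

lemma act_congruence_pullback:
  assumes "right_act M A act" and "act_congruence M A' act' \<sigma>"
    and "\<And>a. a \<in> A \<Longrightarrow> h a \<in> A'"
    and "\<And>a m. \<lbrakk>a \<in> A; m \<in> carrier M\<rbrakk> \<Longrightarrow> h (act a m) = act' (h a) m"
  shows "act_congruence M A act {(a, b). a \<in> A \<and> b \<in> A \<and> (h a, h b) \<in> \<sigma>}"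
proof -
  interpret right_act M A act by fact
  have "equiv A' \<sigma>" using assms(2) unfolding act_congruence_def by blast
  hence "equiv A {(a, b). a \<in> A \<and> b \<in> A \<and> (h a, h b) \<in> \<sigma>}"
    using assms(3) unfolding equiv_def refl_on_def sym_def trans_def by blast
  moreover have "(act' a m, act' b m) \<in> \<sigma>" if "(a, b) \<in> \<sigma>" "m \<in> carrier M" for a b m
    using assms(2) that unfolding act_congruence_def by blast
  ultimately show ?thesis
    unfolding act_congruence_def using act_closed assms(4) by auto
qed

lemma acts_isomorphic_trans:
  assumes "acts_isomorphic M A act A' act'" and "acts_isomorphic M A' act' A'' act''"
  shows "acts_isomorphic M A act A'' act''"
proof -
  obtain f g where f: "bij_betw f A A'" "\<forall>a\<in>A. \<forall>m\<in>carrier M. f (act a m) = act' (f a) m"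
    and g: "bij_betw g A' A''" "\<forall>a\<in>A'. \<forall>m\<in>carrier M. g (act' a m) = act'' (g a) m"
    using assms unfolding acts_isomorphic_def by blast
  have "bij_betw (g \<circ> f) A A''" using f(1) g(1) by (rule bij_betw_trans)
  moreover have "\<forall>a\<in>A. \<forall>m\<in>carrier M. (g \<circ> f) (act a m) = act'' ((g \<circ> f) a) m"
    using f g by (auto dest: bij_betwE)
  ultimately show ?thesis unfolding acts_isomorphic_def by blast
qed

lemma acts_isomorphic_generated_quotient:
  assumes A: "right_act M A act" and A': "right_act M A' act'"
    and h: "bij_betw h A A'"
    and hom: "\<And>a m. \<lbrakk>a \<in> A; m \<in> carrier M\<rbrakk> \<Longrightarrow> h (act a m) = act' (h a) m"
    and R: "R \<subseteq> A \<times> A"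
  defines "\<rho> \<equiv> generated_congruence M A act R"
    and "\<sigma> \<equiv> generated_congruence M A' act' (map_prod h h ` R)"
  shows "acts_isomorphic M (A // \<rho>) (quotient_act \<rho> act) (A' // \<sigma>) (quotient_act \<sigma> act')"
proof -
  interpret A: right_act M A act by fact
  interpret A': right_act M A' act' by fact
  define k where "k = inv_into A h"
  have hA: "h a \<in> A'" if "a \<in> A" for a using h that by (auto dest: bij_betwE)
  have kA: "k a \<in> A" "h (k a) = a" if "a \<in> A'" for a
    using h that unfolding k_def bij_betw_def by (auto intro: inv_into_into f_inv_into_f)
  have kh: "k (h a) = a" if "a \<in> A" for a
    using h that unfolding k_def by (rule bij_betw_inv_into_left)
  have khom: "k (act' a m) = act (k a) m" if "a \<in> A'" "m \<in> carrier M" for a m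
    using hom[OF kA(1)[OF that(1)] that(2)] kA[OF that(1)] kh A.act_closed that(2) by metis
  have S: "map_prod h h ` R \<subseteq> A' \<times> A'" using R hA by auto
  have \<rho>: "act_congruence M A act \<rho>"
    unfolding \<rho>_def by (rule generated_congruence[OF A R])
  have \<sigma>: "act_congruence M A' act' \<sigma>"
    unfolding \<sigma>_def by (rule generated_congruence[OF A' S])
  have e: "equiv A \<rho>" "equiv A' \<sigma>" using \<rho> \<sigma> unfolding act_congruence_def by blast+
  have fwd: "\<rho> \<subseteq> {(a, b). a \<in> A \<and> b \<in> A \<and> (h a, h b) \<in> \<sigma>}"
    unfolding \<rho>_def
  proof (rule generated_congruence_least)
    show "act_congruence M A act {(a, b). a \<in> A \<and> b \<in> A \<and> (h a, h b) \<in> \<sigma>}"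
      by (rule act_congruence_pullback[OF A \<sigma>]) (simp_all add: hA hom)
    show "R \<subseteq> {(a, b). a \<in> A \<and> b \<in> A \<and> (h a, h b) \<in> \<sigma>}"
      using R generated_congruence_base[of "map_prod h h ` R" M A' act'] unfolding \<sigma>_def by force
  qed
  have bwd: "\<sigma> \<subseteq> {(a, b). a \<in> A' \<and> b \<in> A' \<and> (k a, k b) \<in> \<rho>}"
    unfolding \<sigma>_def
  proof (rule generated_congruence_least)
    show "act_congruence M A' act' {(a, b). a \<in> A' \<and> b \<in> A' \<and> (k a, k b) \<in> \<rho>}"
      by (rule act_congruence_pullback[OF A' \<rho>]) (simp_all add: kA khom)
    have "(k (h a), k (h b)) \<in> \<rho>" if "(a, b) \<in> R" for a b
    proof -
      have "a \<in> A" "b \<in> A" "(a, b) \<in> \<rho>"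
        using that R generated_congruence_base[of R M A act] unfolding \<rho>_def by blast+
      thus ?thesis by (simp add: kh)
    qed
    thus "map_prod h h ` R \<subseteq> {(a, b). a \<in> A' \<and> b \<in> A' \<and> (k a, k b) \<in> \<rho>}"
      using S by auto
  qed
  have cls: "h ` (\<rho> `` {a}) = \<sigma> `` {h a}" if "a \<in> A" for a
  proof
    show "h ` (\<rho> `` {a}) \<subseteq> \<sigma> `` {h a}" using fwd by auto
    show "\<sigma> `` {h a} \<subseteq> h ` (\<rho> `` {a})"
    proof
      fix b assume "b \<in> \<sigma> `` {h a}"
      hence "b \<in> A'" "(a, k b) \<in> \<rho>" using bwd kh[OF that] by auto
      thus "b \<in> h ` (\<rho> `` {a})" using kA(2) by force
    qed
  qed
  have "inj_on ((`) h) (A // \<rho>)"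
  proof (rule inj_onI)
    fix C D assume "C \<in> A // \<rho>" "D \<in> A // \<rho>" and eq: "h ` C = h ` D"
    hence "C \<subseteq> A" "D \<subseteq> A" using e(1) by (auto elim!: quotientE simp: equiv_def)
    thus "C = D" using h eq unfolding bij_betw_def by (meson inj_on_image_eq_iff)
  qed
  moreover have "(`) h ` (A // \<rho>) = A' // \<sigma>"
  proof
    show "(`) h ` (A // \<rho>) \<subseteq> A' // \<sigma>"
      by (auto elim!: quotientE simp: cls hA intro!: quotientI)
    show "A' // \<sigma> \<subseteq> (`) h ` (A // \<rho>)"
    proof
      fix C assume "C \<in> A' // \<sigma>"
      then obtain b where b: "b \<in> A'" "C = \<sigma> `` {b}" by (auto elim: quotientE)
      hence "C = h ` (\<rho> `` {k b})" using cls[OF kA(1)[OF b(1)]] kA(2) by simp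
      thus "C \<in> (`) h ` (A // \<rho>)" using quotientI[OF kA(1)[OF b(1)]] by blast
    qed
  qed
  ultimately have "bij_betw ((`) h) (A // \<rho>) (A' // \<sigma>)" unfolding bij_betw_def by blast
  moreover have "h ` quotient_act \<rho> act C m = quotient_act \<sigma> act' (h ` C) m"
    if C: "C \<in> A // \<rho>" and m: "m \<in> carrier M" for C m
  proof -
    obtain a where a: "a \<in> A" "C = \<rho> `` {a}" using C by (auto elim: quotientE)
    show ?thesis
      by (simp add: a cls hA hom A.act_closed m
          quotient_act_class[OF \<rho>] quotient_act_class[OF \<sigma>])
  qed
  ultimately show ?thesis unfolding acts_isomorphic_def by blast
qed

lemma finitely_presentedI:
  fixes M :: "('m, 'k) monoid_scheme" and X :: "'x set"
  assumes "monoid M" and fin: "finite X" "finite R" and d: "defined_by M A act X R"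
  shows "finitely_presented M A act"
proof -
  obtain g :: "'x \<Rightarrow> nat" where g: "inj_on g X"
    using fin(1) finite_imp_inj_to_nat_seg by blast
  define h :: "'x \<times> 'm \<Rightarrow> nat \<times> 'm" where "h = map_prod g id"
  let ?F = "free_carrier M X" and ?F' = "free_carrier M (g ` X)" and ?S = "map_prod h h ` R"
  have X: "X \<noteq> {}" and R: "R \<subseteq> ?F \<times> ?F"
    using d unfolding defined_by_def act_presentation_def by auto
  have h: "bij_betw h ?F ?F'"
    using g unfolding h_def free_carrier_def bij_betw_def inj_on_def by force
  have S: "?S \<subseteq> ?F' \<times> ?F'" using R bij_betwE[OF h] by fastforce
  have iso: "acts_isomorphic M (?F // generated_congruence M ?F (free_act M) R)
        (quotient_act (generated_congruence M ?F (free_act M) R) (free_act M))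
        (?F' // generated_congruence M ?F' (free_act M) ?S)
        (quotient_act (generated_congruence M ?F' (free_act M) ?S) (free_act M))"
    by (rule acts_isomorphic_generated_quotient[OF right_act_free right_act_free h _ R])
      (use assms(1) X in \<open>auto simp: h_def free_act_def\<close>)
  have "defined_by M A act (g ` X) ?S"
    using d X S acts_isomorphic_trans[of M A act, OF _ iso]
    unfolding defined_by_def act_presentation_def by (simp add: Let_def)
  thus ?thesis using fin unfolding finitely_presented_def by blast
qed

end

theory Submission
  imports Defs
begin

text \<open>Let \<open>A/B = \<langle>X | R\<rangle>\<close> and \<open>B = \<langle>Y | S\<rangle>\<close>. Lifting each generator in \<open>X\<close> to a representative in \<open>A\<close>
  gives a surjection \<open>\<phi>\<close> from the free act on the disjoint union of \<open>X\<close> and \<open>Y\<close> onto \<open>A\<close>. Its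
  kernel is generated by \<open>S\<close>, those relations of \<open>R\<close> that hold in \<open>A\<close>, and, for finitely many
  \<open>u\<close> over \<open>X\<close> with \<open>\<phi> u \<in> B\<close>, one relation equating \<open>u\<close> with a word over \<open>Y\<close>: \<open>u\<close> runs through the
  sides of relations in \<open>R\<close> and one word \<open>u\<^sub>0\<close> representing the zero of \<open>A/B\<close>. Indeed, if
  \<open>\<phi> u \<in> B\<close> then \<open>R\<close> makes \<open>u\<close> equal to \<open>u\<^sub>0\<close>, and following this derivation
  turns \<open>u\<close> into a word over \<open>Y\<close>.\<close>

section \<open>Quotients of acts as surjections with a given kernel\<close>

text \<open>The class map followed by the inverse of the isomorphism serves as \<phi>. Through it
  words are compared by their values in \<open>A\<close>, and classes of words drop out of the later
  argument.\<close>

lemma acts_isomorphic_quotientD: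
  assumes A: "right_act M A act" and F: "right_act M F actF"
    and \<rho>: "act_congruence M F actF \<rho>"
    and iso: "acts_isomorphic M A act (F // \<rho>) (quotient_act \<rho> actF)"
  obtains \<phi> where "\<phi> ` F = A"
    and "\<And>u m. \<lbrakk>u \<in> F; m \<in> carrier M\<rbrakk> \<Longrightarrow> \<phi> (actF u m) = act (\<phi> u) m"
    and "\<And>u v. \<lbrakk>u \<in> F; v \<in> F\<rbrakk> \<Longrightarrow> \<phi> u = \<phi> v \<longleftrightarrow> (u, v) \<in> \<rho>"
proof -
  interpret A: right_act M A act by fact
  interpret F: right_act M F actF by fact
  obtain f where f: "bij_betw f A (F // \<rho>)"
    and hom: "\<forall>a\<in>A. \<forall>m\<in>carrier M. f (act a m) = quotient_act \<rho> actF (f a) m"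
    using iso unfolding acts_isomorphic_def by blast
  have eq: "equiv F \<rho>" using \<rho> unfolding act_congruence_def by blast
  define \<phi> where "\<phi> u = inv_into A f (\<rho> `` {u})" for u
  have inA: "\<phi> u \<in> A" and f\<phi>: "f (\<phi> u) = \<rho> `` {u}" if "u \<in> F" for u
  proof -
    have "\<rho> `` {u} \<in> f ` A" using f quotientI[OF that, of \<rho>] unfolding bij_betw_def by simp
    thus "\<phi> u \<in> A" "f (\<phi> u) = \<rho> `` {u}"
      unfolding \<phi>_def by (rule inv_into_into, rule f_inv_into_f)
  qed
  have "\<phi> ` F = A"
  proof
    show "\<phi> ` F \<subseteq> A" using inA by blast
    show "A \<subseteq> \<phi> ` F"
    proof
      fix a assume a: "a \<in> A"
      hence "f a \<in> F // \<rho>" using bij_betwE[OF f] by blast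
      then obtain u where u: "u \<in> F" "f a = \<rho> `` {u}" by (rule quotientE)
      hence "\<phi> u = a" unfolding \<phi>_def using f a by (metis bij_betw_inv_into_left)
      thus "a \<in> \<phi> ` F" using u(1) by blast
    qed
  qed
  moreover have "\<phi> (actF u m) = act (\<phi> u) m" if u: "u \<in> F" and m: "m \<in> carrier M" for u m
  proof -
    have "f (act (\<phi> u) m) = \<rho> `` {actF u m}"
      using hom inA[OF u] f\<phi>[OF u] m quotient_act_class[OF \<rho> u m] by simp
    thus ?thesis
      using f A.act_closed[OF inA[OF u] m] unfolding \<phi>_def by (metis bij_betw_inv_into_left)
  qed
  moreover have "\<phi> u = \<phi> v \<longleftrightarrow> (u, v) \<in> \<rho>" if "u \<in> F" "v \<in> F" for u v
    using f\<phi>[OF that(1)] f\<phi>[OF that(2)] eq_equiv_class_iff[OF eq that] unfolding \<phi>_def by metis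
  ultimately show thesis using that by blast
qed

text \<open>Since \<rho> is the kernel of \<phi>, the fibres of \<phi> are exactly the classes of
  \<rho>; sending each element of \<open>A\<close> to its fibre is the isomorphism.\<close>

lemma acts_isomorphic_quotientI:
  assumes F: "right_act M F actF" and \<rho>: "act_congruence M F actF \<rho>"
    and onto: "\<phi> ` F = A"
    and hom: "\<And>u m. \<lbrakk>u \<in> F; m \<in> carrier M\<rbrakk> \<Longrightarrow> \<phi> (actF u m) = act (\<phi> u) m"
    and ker: "\<And>u v. \<lbrakk>u \<in> F; v \<in> F\<rbrakk> \<Longrightarrow> \<phi> u = \<phi> v \<longleftrightarrow> (u, v) \<in> \<rho>"
  shows "acts_isomorphic M A act (F // \<rho>) (quotient_act \<rho> actF)"
proof -
  interpret F: right_act M F actF by fact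
  have eq: "equiv F \<rho>" using \<rho> unfolding act_congruence_def by blast
  define f where "f a = {u \<in> F. \<phi> u = a}" for a
  have f\<phi>: "f (\<phi> u) = \<rho> `` {u}" if u: "u \<in> F" for u
    using eq_equiv_class_iff[OF eq] ker u equiv_type[OF eq] unfolding f_def by fastforce
  have "inj_on f A"
    using onto unfolding f_def inj_on_def by blast
  moreover have "f ` A = F // \<rho>"
    using f\<phi> onto unfolding quotient_def by force
  ultimately have "bij_betw f A (F // \<rho>)" unfolding bij_betw_def by blast
  moreover have "f (act a m) = quotient_act \<rho> actF (f a) m"
    if a: "a \<in> A" and m: "m \<in> carrier M" for a m
  proof -
    obtain u where u: "u \<in> F" "a = \<phi> u" using a onto by blast
    show ?thesis
      using f\<phi>[OF F.act_closed[OF u(1) m]]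
      by (simp add: u f\<phi> hom[OF u(1) m, symmetric] m quotient_act_class[OF \<rho> u(1) m])
  qed
  ultimately show ?thesis unfolding acts_isomorphic_def by blast
qed

lemma kernel_congruence:
  assumes F: "right_act M F actF"
    and hom: "\<And>u m. \<lbrakk>u \<in> F; m \<in> carrier M\<rbrakk> \<Longrightarrow> \<phi> (actF u m) = act (\<phi> u) m"
  shows "act_congruence M F actF {(u, v). u \<in> F \<and> v \<in> F \<and> \<phi> u = \<phi> v}"
proof -
  interpret right_act M F actF by fact
  show ?thesis
    unfolding act_congruence_def using act_closed hom
    by (auto intro!: equivI simp: refl_on_def sym_def trans_def)
qed

lemma finitely_presentedD:
  assumes "monoid M" and A: "right_act M A act" and "finitely_presented M A act"
  obtains X :: "nat set" and R \<phi> where "finite X" and "finite R" and "X \<noteq> {}"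
    and "R \<subseteq> free_carrier M X \<times> free_carrier M X"
    and "\<phi> ` free_carrier M X = A"
    and "\<And>u m. \<lbrakk>u \<in> free_carrier M X; m \<in> carrier M\<rbrakk> \<Longrightarrow> \<phi> (free_act M u m) = act (\<phi> u) m"
    and "\<And>u v. \<lbrakk>u \<in> free_carrier M X; v \<in> free_carrier M X\<rbrakk> \<Longrightarrow>
      \<phi> u = \<phi> v \<longleftrightarrow> (u, v) \<in> generated_congruence M (free_carrier M X) (free_act M) R"
proof -
  obtain X :: "nat set" and R where fin: "finite X" "finite R" and d: "defined_by M A act X R"
    using assms(3) unfolding finitely_presented_def by blast
  have X: "X \<noteq> {}" and R: "R \<subseteq> free_carrier M X \<times> free_carrier M X"
    using d unfolding defined_by_def act_presentation_def by auto
  note F = right_act_free[OF assms(1) X]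
  have "acts_isomorphic M A act
      (free_carrier M X // generated_congruence M (free_carrier M X) (free_act M) R)
      (quotient_act (generated_congruence M (free_carrier M X) (free_act M) R) (free_act M))"
    using d unfolding defined_by_def by (simp add: Let_def)
  from acts_isomorphic_quotientD[OF A F generated_congruence[OF F R] this]
  show thesis using that[OF fin X R] by blast
qed

lemma rees_class:
  assumes "subact M A act B" and "a \<in> A"
  shows "rees_congruence A B `` {a} = (if a \<in> B then B else {a})"
  using assms unfolding rees_congruence_def subact_def by auto

theorem corollary4p4:
  fixes M :: "('m, 'k) monoid_scheme"
    and A B :: "'a set"
    and act :: "'a \<Rightarrow> 'm \<Rightarrow> 'a"
  assumes "monoid M"
    and "right_act M A act"
    and "subact M A act B"
    and "finitely_presented M B act"
    and "finitely_presented M (A // rees_congruence A B) (quotient_act (rees_congruence A B) act)"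
  shows "finitely_presented M A act"
proof -
  interpret A: right_act M A act by fact
  note cong = rees_congruence[OF assms(3,2)]
  have BA: "B \<subseteq> A" and Bne: "B \<noteq> {}"
    using assms(3) unfolding subact_def by auto
  note cls = rees_class[OF assms(3)]

  \<comment> \<open>The surjection \<phi> from the free act on \<open>X <+> Y\<close> onto
    \<open>A\<close>\<close>
  obtain X :: "nat set" and R \<psi> where X: "finite X" "finite R" "X \<noteq> {}"
    and R: "R \<subseteq> free_carrier M X \<times> free_carrier M X"
    and \<psi>: "\<psi> ` free_carrier M X = A // rees_congruence A B"
    and \<psi>_hom: "\<And>u m. \<lbrakk>u \<in> free_carrier M X; m \<in> carrier M\<rbrakk> \<Longrightarrow>
      \<psi> (free_act M u m) = quotient_act (rees_congruence A B) act (\<psi> u) m"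
    and \<psi>_ker: "\<And>u v. \<lbrakk>u \<in> free_carrier M X; v \<in> free_carrier M X\<rbrakk> \<Longrightarrow>
      \<psi> u = \<psi> v \<longleftrightarrow> (u, v) \<in> generated_congruence M (free_carrier M X) (free_act M) R"
    by (rule finitely_presentedD[OF assms(1) right_act_quotient[OF cong assms(2)] assms(5)]) (rule that)
  obtain Y :: "nat set" and S \<chi> where Y: "finite Y" "finite S" "Y \<noteq> {}"
    and S: "S \<subseteq> free_carrier M Y \<times> free_carrier M Y"
    and \<chi>: "\<chi> ` free_carrier M Y = B"
    and \<chi>_hom: "\<And>u m. \<lbrakk>u \<in> free_carrier M Y; m \<in> carrier M\<rbrakk> \<Longrightarrow> \<chi> (free_act M u m) = act (\<chi> u) m"
    and \<chi>_ker: "\<And>u v. \<lbrakk>u \<in> free_carrier M Y; v \<in> free_carrier M Y\<rbrakk> \<Longrightarrow>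
      \<chi> u = \<chi> v \<longleftrightarrow> (u, v) \<in> generated_congruence M (free_carrier M Y) (free_act M) S"
    by (rule finitely_presentedD[OF assms(1) right_act_subact[OF assms(3,2)] assms(4)]) (rule that)
  let ?FX = "free_carrier M X" and ?FY = "free_carrier M Y"
  let ?Z = "X <+> Y"
  let ?F = "free_carrier M ?Z"
  define i :: "nat \<times> 'm \<Rightarrow> (nat + nat) \<times> 'm" where "i = map_prod Inl id"
  define j :: "nat \<times> 'm \<Rightarrow> (nat + nat) \<times> 'm" where "j = map_prod Inr id"
  have FX: "right_act M ?FX (free_act M)" and FY: "right_act M ?FY (free_act M)"
    and F: "right_act M ?F (free_act M)"
    using X(3) Y(3) by (auto intro!: right_act_free assms(1))
  interpret FX: right_act M ?FX "free_act M" by (rule FX)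
  interpret FY: right_act M ?FY "free_act M" by (rule FY)
  interpret F: right_act M ?F "free_act M" by (rule F)
  have i: "i u \<in> ?F" "i (free_act M u m) = free_act M (i u) m" if "u \<in> ?FX" for u m
    using that unfolding i_def by (auto simp: free_carrier_def free_act_def)
  have j: "j u \<in> ?F" "j (free_act M u m) = free_act M (j u) m" if "u \<in> ?FY" for u m
    using that unfolding j_def by (auto simp: free_carrier_def free_act_def)
  have F_cases: "(\<exists>x\<in>?FX. u = i x) \<or> (\<exists>y\<in>?FY. u = j y)" if "u \<in> ?F" for u
    using that unfolding i_def j_def free_carrier_def by force

  \<comment> \<open>An element of \<open>A/B\<close> is a subset of \<open>A\<close>, either
    \<open>B\<close> or a singleton, hence non-empty. So \<open>g\<close> can pick a representative
    in \<open>A\<close> for each generator in \<open>X\<close>.\<close>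
  have "\<exists>a. a \<in> \<psi> (x, \<one>\<^bsub>M\<^esub>)" if "x \<in> X" for x
  proof -
    have "\<psi> (x, \<one>\<^bsub>M\<^esub>) \<in> A // rees_congruence A B"
      using \<psi> that by (auto simp: free_carrier_def)
    thus ?thesis using Bne by (auto elim!: quotientE simp: cls)
  qed
  then obtain g where g: "\<And>x. x \<in> X \<Longrightarrow> g x \<in> \<psi> (x, \<one>\<^bsub>M\<^esub>)" by metis
  \<comment> \<open>The homomorphism that extends \<open>g\<close> on \<open>X\<close> and the
    values under \<chi> of the generators in \<open>Y\<close>.\<close>
  define \<phi> where "\<phi> p = act (case_sum g (\<lambda>y. \<chi> (y, \<one>\<^bsub>M\<^esub>)) (fst p)) (snd p)" for p
  have \<phi>j: "\<phi> (j u) = \<chi> u" if "u \<in> ?FY" for u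
    using that \<chi>_hom[of "(fst u, \<one>\<^bsub>M\<^esub>)" "snd u"]
    by (auto simp: \<phi>_def j_def free_carrier_def free_act_def)
  have \<psi>_class: "\<psi> u = rees_congruence A B `` {a}" "a \<in> A" if "u \<in> ?FX" "a \<in> \<psi> u" for u a
  proof -
    have "\<psi> u \<in> A // rees_congruence A B" using \<psi> that(1) by blast
    then obtain a' where a': "a' \<in> A" "\<psi> u = rees_congruence A B `` {a'}" by (rule quotientE)
    show "a \<in> A" using a' that(2) BA by (auto simp: cls split: if_splits)
    thus "\<psi> u = rees_congruence A B `` {a}" using a' that(2) by (simp add: cls split: if_splits)
  qed
  have gA: "g x \<in> A" if "x \<in> X" for x
    using \<psi>_class(2)[of "(x, \<one>\<^bsub>M\<^esub>)"] g[OF that] that by (auto simp: free_carrier_def)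
  have cA: "case_sum g (\<lambda>y. \<chi> (y, \<one>\<^bsub>M\<^esub>)) z \<in> A" if "z \<in> ?Z" for z
    using that gA \<chi> BA by (force simp: free_carrier_def)
  have \<phi>_hom: "\<phi> (free_act M u m) = act (\<phi> u) m" if "u \<in> ?F" "m \<in> carrier M" for u m
  proof -
    have "fst u \<in> ?Z" "snd u \<in> carrier M" using that(1) by (auto simp: free_carrier_def)
    thus ?thesis unfolding \<phi>_def free_act_def using A.act_mult cA that(2) by simp
  qed
  have \<phi>A: "\<phi> u \<in> A" if "u \<in> ?F" for u
    unfolding \<phi>_def using that by (intro A.act_closed cA) (auto simp: free_carrier_def)
  \<comment> \<open>\<psi> is \<phi> after \<open>i\<close>, followed by the projection of
    \<open>A\<close> onto \<open>A/B\<close>: the choice of \<open>g\<close> gives agreement on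
    generators, and the action extends it to all words.\<close>
  have \<phi>i: "\<psi> u = rees_congruence A B `` {\<phi> (i u)}" if "u \<in> ?FX" for u
  proof -
    obtain x m where u: "u = (x, m)" "x \<in> X" "m \<in> carrier M"
      using \<open>u \<in> ?FX\<close> by (auto simp: free_carrier_def)
    have x1: "(x, \<one>\<^bsub>M\<^esub>) \<in> ?FX" using u by (simp add: free_carrier_def)
    have "\<psi> u = quotient_act (rees_congruence A B) act (\<psi> (x, \<one>\<^bsub>M\<^esub>)) m"
      using \<psi>_hom[OF x1 u(3)] u by (simp add: free_act_def)
    also have "\<dots> = rees_congruence A B `` {act (g x) m}"
      using \<psi>_class(1)[OF x1 g[OF u(2)]] quotient_act_class[OF cong gA[OF u(2)] u(3)] by simp
    finally show ?thesis by (simp add: \<phi>_def i_def u(1))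
  qed
  have \<psi>_eq: "\<psi> u = \<psi> v \<longleftrightarrow> \<phi> (i u) = \<phi> (i v) \<or> \<phi> (i u) \<in> B \<and> \<phi> (i v) \<in> B"
    if "u \<in> ?FX" "v \<in> ?FX" for u v
    using \<phi>i[OF that(1)] \<phi>i[OF that(2)] \<phi>A[OF i(1)[OF that(1)]] \<phi>A[OF i(1)[OF that(2)]]
    by (auto simp: cls)
  have onto: "\<phi> ` ?F = A"
  proof
    show "\<phi> ` ?F \<subseteq> A" using \<phi>A by blast
    show "A \<subseteq> \<phi> ` ?F"
    proof
      fix a assume a: "a \<in> A"
      show "a \<in> \<phi> ` ?F"
      proof (cases "a \<in> B")
        case True
        then obtain v where "v \<in> ?FY" "a = \<chi> v" using \<chi> by blast
        thus ?thesis using \<phi>j j(1) by (metis imageI)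
      next
        case False
        \<comment> \<open>Outside \<open>B\<close> the Rees classes are singletons, so a word over
          \<open>X\<close> for the class of \<open>a\<close> takes the value \<open>a\<close>
          itself.\<close>
        obtain u where u: "u \<in> ?FX" "\<psi> u = rees_congruence A B `` {a}"
          using \<psi> quotientI[OF a] by (metis imageE)
        hence "\<phi> (i u) = a"
          using \<phi>i[OF u(1)] False \<phi>A[OF i(1)[OF u(1)]] a by (auto simp: cls split: if_splits)
        thus ?thesis using i(1)[OF u(1)] by blast
      qed
    qed
  qed

  \<comment> \<open>The finite set \<open>T\<close> of relations and the congruence \<tau> it
    generates\<close>
  obtain b where b: "b \<in> B" using Bne by blast
  \<comment> \<open>If no side of a relation in \<open>R\<close> has its value in \<open>B\<close>,
    this word is the only link between words over \<open>X\<close> and words over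
    \<open>Y\<close>.\<close>
  then obtain u0 where u0: "u0 \<in> ?FX" "\<psi> u0 = rees_congruence A B `` {b}"
    using \<psi> quotientI[of b A] BA by (metis imageE subsetD)
  have u0B: "\<phi> (i u0) \<in> B"
    using \<phi>i[OF u0(1)] u0(2) b BA \<phi>A[OF i(1)[OF u0(1)]] by (auto simp: cls split: if_splits)
  have "\<exists>v\<in>?FY. \<chi> v = \<phi> (i u)" if "\<phi> (i u) \<in> B" for u
    using \<chi> that by (metis imageE)
  then obtain w where w: "\<And>u. \<phi> (i u) \<in> B \<Longrightarrow> w u \<in> ?FY \<and> \<chi> (w u) = \<phi> (i u)" by metis
  define K where "K = insert u0 {u \<in> fst ` R \<union> snd ` R. \<phi> (i u) \<in> B}"
  have K: "u \<in> ?FX" "\<phi> (i u) \<in> B" if "u \<in> K" for u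
    using that u0(1) u0B R unfolding K_def by auto
  \<comment> \<open>A relation of \<open>R\<close> that fails in \<open>A\<close> has both sides in
    \<open>K\<close> by \<open>\<psi>_eq\<close>. It is dropped, and each of its sides is tied to a
    word over \<open>Y\<close> instead.\<close>
  define T where "T = map_prod j j ` S \<union> map_prod i i ` {(u, v) \<in> R. \<phi> (i u) = \<phi> (i v)}
    \<union> (\<lambda>u. (i u, j (w u))) ` K"
  have "finite {(u, v) \<in> R. \<phi> (i u) = \<phi> (i v)}"
    by (rule finite_subset[OF _ X(2)]) blast
  moreover have "finite K" unfolding K_def using X(2) by simp
  ultimately have finT: "finite T" unfolding T_def using Y(2) by simp
  define \<tau> where "\<tau> = generated_congruence M ?F (free_act M) T"
  have T: "T \<subseteq> ?F \<times> ?F"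
  proof -
    have "map_prod j j ` S \<subseteq> ?F \<times> ?F"
      using S j(1) by auto
    moreover have "map_prod i i ` {(u, v) \<in> R. \<phi> (i u) = \<phi> (i v)} \<subseteq> ?F \<times> ?F"
      using R i(1) by auto
    moreover have "(i u, j (w u)) \<in> ?F \<times> ?F" if "u \<in> K" for u
      using i(1)[OF K(1)[OF that]] j(1) w[OF K(2)[OF that]] by blast
    ultimately show ?thesis unfolding T_def by blast
  qed
  have \<tau>: "act_congruence M ?F (free_act M) \<tau>"
    unfolding \<tau>_def by (rule generated_congruence[OF F T])
  have eq: "equiv ?F \<tau>"
    and \<tau>_act: "\<And>u v m. \<lbrakk>(u, v) \<in> \<tau>; m \<in> carrier M\<rbrakk> \<Longrightarrow> (free_act M u m, free_act M v m) \<in> \<tau>"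
    using \<tau> unfolding act_congruence_def by auto
  have T\<tau>: "T \<subseteq> \<tau>" unfolding \<tau>_def by (rule generated_congruence_base)
  have \<tau>_sym: "\<And>u v. (u, v) \<in> \<tau> \<Longrightarrow> (v, u) \<in> \<tau>"
    using eq unfolding equiv_def sym_def by blast
  have \<tau>_trans: "\<And>u v x. \<lbrakk>(u, v) \<in> \<tau>; (v, x) \<in> \<tau>\<rbrakk> \<Longrightarrow> (u, x) \<in> \<tau>"
    using eq unfolding equiv_def trans_def by blast
  have \<tau>_refl: "\<And>u. u \<in> ?F \<Longrightarrow> (u, u) \<in> \<tau>"
    using eq unfolding equiv_def refl_on_def by blast

  \<comment> \<open>Soundness: every relation in \<open>T\<close> holds in \<open>A\<close>, the
    links from \<open>K\<close> by the choice of \<open>w\<close>.\<close>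
  have "\<tau> \<subseteq> {(u, v). u \<in> ?F \<and> v \<in> ?F \<and> \<phi> u = \<phi> v}"
    unfolding \<tau>_def
  proof (rule generated_congruence_least)
    show "act_congruence M ?F (free_act M) {(u, v). u \<in> ?F \<and> v \<in> ?F \<and> \<phi> u = \<phi> v}"
      by (rule kernel_congruence[OF F]) (rule \<phi>_hom)
    have "\<phi> (j u) = \<phi> (j v)" if "(u, v) \<in> S" for u v
    proof -
      have uv: "u \<in> ?FY" "v \<in> ?FY" using that S by auto
      have "(u, v) \<in> generated_congruence M ?FY (free_act M) S"
        using that generated_congruence_base by blast
      thus ?thesis using \<chi>_ker[OF uv] \<phi>j uv by simp
    qed
    moreover have "\<phi> (i u) = \<phi> (j (w u))" if "u \<in> K" for u
      using w[OF K(2)[OF that]] \<phi>j by simp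
    ultimately show "T \<subseteq> {(u, v). u \<in> ?F \<and> v \<in> ?F \<and> \<phi> u = \<phi> v}"
      using T unfolding T_def by auto
  qed
  hence \<tau>_ker: "\<phi> u = \<phi> v" if "(u, v) \<in> \<tau>" for u v using that by blast

  \<comment> \<open>Words identified by \<tau>\<close>
  have jj: "(j u, j v) \<in> \<tau>" if "u \<in> ?FY" "v \<in> ?FY" "\<chi> u = \<chi> v" for u v
  proof -
    \<comment> \<open>The pullback of \<tau> along \<open>j\<close> is a congruence containing
      \<open>S\<close>, so it contains the kernel of \<chi>.\<close>
    have "generated_congruence M ?FY (free_act M) S \<subseteq>
        {(u, v). u \<in> ?FY \<and> v \<in> ?FY \<and> (j u, j v) \<in> \<tau>}"
    proof (rule generated_congruence_least)
      show "act_congruence M ?FY (free_act M) {(u, v). u \<in> ?FY \<and> v \<in> ?FY \<and> (j u, j v) \<in> \<tau>}"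
        by (rule act_congruence_pullback[OF FY \<tau>]) (simp_all add: j)
      show "S \<subseteq> {(u, v). u \<in> ?FY \<and> v \<in> ?FY \<and> (j u, j v) \<in> \<tau>}"
        using S T\<tau> unfolding T_def by force
    qed
    thus ?thesis using \<chi>_ker that by blast
  qed

  \<comment> \<open>The words over \<open>X\<close> that \<tau> turns into words over
    \<open>Y\<close>. All have values in \<open>B\<close>; the converse is \<open>B_N\<close>
    below.\<close>
  define N where "N = {u \<in> ?FX. \<exists>v\<in>?FY. (i u, j v) \<in> \<tau>}"
  have KN: "u \<in> N" if "u \<in> K" for u
    using that K(1) w[OF K(2)[OF that]] T\<tau> unfolding N_def T_def by blast
  have N_act: "free_act M u m \<in> N" if u: "u \<in> N" and m: "m \<in> carrier M" for u m
  proof -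
    obtain v where v: "u \<in> ?FX" "v \<in> ?FY" "(i u, j v) \<in> \<tau>" using u unfolding N_def by blast
    have "(i (free_act M u m), j (free_act M v m)) \<in> \<tau>"
      using \<tau>_act[OF v(3) m] i(2)[OF v(1)] j(2)[OF v(2)] by simp
    thus ?thesis using FX.act_closed[OF v(1) m] FY.act_closed[OF v(2) m] unfolding N_def by blast
  qed
  have N_\<tau>: "u \<in> N" if "v \<in> N" "u \<in> ?FX" "(i u, i v) \<in> \<tau>" for u v
    using that \<tau>_trans unfolding N_def by blast
  have N_B: "\<phi> (i u) \<in> B" if "u \<in> N" for u
  proof -
    obtain v where "v \<in> ?FY" "(i u, j v) \<in> \<tau>" using \<open>u \<in> N\<close> unfolding N_def by blast
    thus ?thesis using \<tau>_ker \<phi>j \<chi> by (metis imageI)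
  qed
  \<comment> \<open>The pullback of \<tau> along \<open>i\<close> with \<open>N\<close> collapsed to
    a point, imitating the Rees congruence. Transitivity rests on \<open>N\<close> being saturated
    for \<tau>, compatibility on \<open>N\<close> being closed under the action.\<close>
  define \<sigma> where "\<sigma> = {(u, v). u \<in> ?FX \<and> v \<in> ?FX \<and> ((i u, i v) \<in> \<tau> \<or> u \<in> N \<and> v \<in> N)}"
  have "generated_congruence M ?FX (free_act M) R \<subseteq> \<sigma>"
  proof (rule generated_congruence_least)
    have "equiv ?FX \<sigma>"
    proof (rule equivI)
      show "\<sigma> \<subseteq> ?FX \<times> ?FX" unfolding \<sigma>_def by blast
      show "refl_on ?FX \<sigma>" unfolding \<sigma>_def refl_on_def using \<tau>_refl i(1) by blast
      show "sym \<sigma>" unfolding \<sigma>_def sym_def using \<tau>_sym by blast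
      show "trans \<sigma>"
      proof (rule transI)
        fix u v x assume "(u, v) \<in> \<sigma>" "(v, x) \<in> \<sigma>"
        thus "(u, x) \<in> \<sigma>" unfolding \<sigma>_def using \<tau>_trans \<tau>_sym N_\<tau> by blast
      qed
    qed
    moreover have "(free_act M u m, free_act M v m) \<in> \<sigma>"
      if uv: "(u, v) \<in> \<sigma>" and m: "m \<in> carrier M" for u v m
    proof -
      have F: "u \<in> ?FX" "v \<in> ?FX" and "(i u, i v) \<in> \<tau> \<or> u \<in> N \<and> v \<in> N"
        using uv unfolding \<sigma>_def by auto
      hence "(i (free_act M u m), i (free_act M v m)) \<in> \<tau>
          \<or> free_act M u m \<in> N \<and> free_act M v m \<in> N"
        using \<tau>_act[OF _ m] N_act[OF _ m] i(2)[OF F(1)] i(2)[OF F(2)] by metis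
      thus ?thesis unfolding \<sigma>_def using F FX.act_closed m by simp
    qed
    ultimately show "act_congruence M ?FX (free_act M) \<sigma>" unfolding act_congruence_def by blast
    show "R \<subseteq> \<sigma>"
    proof (rule subrelI)
      fix u v assume uv: "(u, v) \<in> R"
      hence uvF: "u \<in> ?FX" "v \<in> ?FX" using R by auto
      have "(u, v) \<in> generated_congruence M ?FX (free_act M) R"
        using uv generated_congruence_base by blast
      \<comment> \<open>In the first case the relation was kept in \<open>T\<close>; in the second
        both sides lie in \<open>K\<close>, hence in \<open>N\<close>.\<close>
      hence "\<phi> (i u) = \<phi> (i v) \<or> \<phi> (i u) \<in> B \<and> \<phi> (i v) \<in> B"
        using \<psi>_ker[OF uvF] \<psi>_eq[OF uvF] by blast
      thus "(u, v) \<in> \<sigma>"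
      proof
        assume "\<phi> (i u) = \<phi> (i v)"
        hence "(i u, i v) \<in> T" using uv unfolding T_def by force
        thus ?thesis using T\<tau> uvF unfolding \<sigma>_def by blast
      next
        assume "\<phi> (i u) \<in> B \<and> \<phi> (i v) \<in> B"
        hence "u \<in> K" "v \<in> K" using uv unfolding K_def by force+
        thus ?thesis using KN uvF unfolding \<sigma>_def by blast
      qed
    qed
  qed
  hence \<psi>\<sigma>: "(u, v) \<in> \<sigma>" if "u \<in> ?FX" "v \<in> ?FX" "\<psi> u = \<psi> v" for u v
    using that \<psi>_ker by blast
  have B_N: "u \<in> N" if u: "u \<in> ?FX" and B: "\<phi> (i u) \<in> B" for u
  proof -
    \<comment> \<open>Both words represent the zero of \<open>A/B\<close>. As \<open>u0\<close> lies
      in \<open>N\<close> and \<open>N\<close> is saturated, either alternative in \<sigma> puts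
      \<open>u\<close> in \<open>N\<close>.\<close>
    have "(u, u0) \<in> \<sigma>" using \<psi>\<sigma>[OF u u0(1)] \<psi>_eq[OF u u0(1)] B u0B by blast
    moreover have "u0 \<in> N" using KN unfolding K_def by blast
    ultimately show ?thesis using N_\<tau> unfolding \<sigma>_def by blast
  qed

  \<comment> \<open>The kernel of \<phi> is \<tau>\<close>
  have reduce: "\<exists>v\<in>?FY. (u, j v) \<in> \<tau>" if "u \<in> ?F" "\<phi> u \<in> B" for u
    using F_cases[OF that(1)]
  proof
    assume "\<exists>x\<in>?FX. u = i x"
    thus ?thesis using B_N that(2) unfolding N_def by blast
  next
    assume "\<exists>y\<in>?FY. u = j y"
    thus ?thesis using \<tau>_refl that(1) by blast
  qed
  have "(u, v) \<in> \<tau>" if uv: "u \<in> ?F" "v \<in> ?F" "\<phi> u = \<phi> v" for u v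
  proof (cases "\<phi> u \<in> B")
    case True
    \<comment> \<open>Both words reduce to words over \<open>Y\<close> with equal values in
      \<open>B\<close>, and \<open>jj\<close> identifies these.\<close>
    then obtain x y where x: "x \<in> ?FY" "(u, j x) \<in> \<tau>" and y: "y \<in> ?FY" "(v, j y) \<in> \<tau>"
      using reduce uv by metis
    hence "\<chi> x = \<chi> y" using \<tau>_ker \<phi>j uv(3) by metis
    hence "(j x, j y) \<in> \<tau>" using jj x(1) y(1) by blast
    thus ?thesis using x(2) y(2) \<tau>_trans \<tau>_sym by blast
  next
    case False
    \<comment> \<open>Words over \<open>Y\<close> take values in \<open>B\<close>, so both words
      come from \<open>X\<close>. They are not in \<open>N\<close>, which leaves only the
      alternative \<tau> in \<sigma>.\<close>
    hence "\<not> (\<exists>y\<in>?FY. u = j y)" "\<not> (\<exists>y\<in>?FY. v = j y)" using uv(3) \<phi>j \<chi> by (metis imageI)+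
    then obtain x y where xy: "x \<in> ?FX" "u = i x" "y \<in> ?FX" "v = i y"
      using F_cases uv(1,2) by blast
    have "(x, y) \<in> \<sigma>" using \<psi>\<sigma> \<psi>_eq xy uv(3) by blast
    moreover have "x \<notin> N" using N_B False xy(2) by blast
    ultimately show ?thesis unfolding \<sigma>_def xy by blast
  qed
  hence ker: "\<phi> u = \<phi> v \<longleftrightarrow> (u, v) \<in> \<tau>" if "u \<in> ?F" "v \<in> ?F" for u v
    using that \<tau>_ker by blast
  have "acts_isomorphic M A act (?F // \<tau>) (quotient_act \<tau> (free_act M))"
    by (rule acts_isomorphic_quotientI[OF F \<tau> onto \<phi>_hom ker])
  hence "defined_by M A act ?Z T"
    using T X(3) unfolding defined_by_def act_presentation_def \<tau>_def by (auto simp: Let_def)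
  \<comment> \<open>The generators lie in a sum type here; \<open>finitely_presentedI\<close>
    renames them to natural numbers.\<close>
  thus ?thesis by (rule finitely_presentedI[OF assms(1) finite_Plus[OF X(1) Y(1)] finT])
qed

end
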